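(* Let $V:S^2\to S^2$ be a $b$-bistochastic quadratic stochastic operator with heredity coefficients $\{P_{ij,k}\}_{i,j,k=1}^3$, and write $$A_1=P_{11,1},\ A_2=P_{11,2},\ B_1=P_{12,1},\ B_2=P_{12,2},\ C_1=P_{13,1},\ C_2=P_{13,2},\ D_2=P_{22,2},\ E_2=P_{23,2}.$$ Then $V$ is a strict contraction if and only if the maximum of the following nine quantities is strictly less than $1$: (a) $|A_1-B_1|+|A_2-B_2|+|A_1+A_2-B_1-B_2|$; (b) $B_1+|B_2-D_2|+|B_1+B_2-D_2|$; (c) $C_1+|C_2-E_2|+|C_1+C_2-E_2|$; (d) $|A_1-C_1|+|A_2-C_2|+|A_1+A_2-C_1-C_2|$; (e) $B_1+|B_2-E_2|+|B_1+B_2-E_2|$; (f) $2C_1+2C_2$; (g) $|B_1-C_1|+|B_2-C_2|+|B_1+B_2-C_1-C_2|$; (h) $2|D_2-E_2|$; (i) $2E_2$.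
   Context: $S^{n-1}=\{\mathbf{x}=(x_1,\dots,x_n)\in\mathbb{R}^n : x_i\ge 0,\ \sum_{i=1}^n x_i=1\}$ (here $n=3$). For $\mathbf{x},\mathbf{y}\in S^{n-1}$ write $\mathbf{x}\le^b\mathbf{y}$ if $\sum_{i=1}^k x_i\le\sum_{i=1}^k y_i$ for all $k\in\{1,\dots,n-1\}$. A quadratic stochastic operator (q.s.o.) is a map $V:S^{n-1}\to S^{n-1}$ of the form $V(\mathbf{x})_k=\sum_{i,j=1}^n P_{ij,k}x_ix_j$, $k=1,\dots,n$, where the heredity coefficients satisfy $P_{ij,k}\ge 0$, $P_{ij,k}=P_{ji,k}$ and $\sum_{k=1}^n P_{ij,k}=1$ for all $i,j,k$. A q.s.o. $V$ is called $b$-bistochastic if $V(\mathbf{x})\le^b\mathbf{x}$ for all $\mathbf{x}\in S^{n-1}$. $V$ is a strict contraction if there exists $\alpha\in[0,1)$ such that $\|V(\mathbf{x})-V(\mathbf{y})\|\le\alpha\|\mathbf{x}-\mathbf{y}\|$ for all $\mathbf{x},\mathbf{y}\in S^{n-1}$, where $\|\mathbf{x}\|=\sum_{i=1}^n|x_i|$. *)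

theory Defs
  imports Complex_Main "HOL-Library.FuncSet"
begin

text \<open>
  Points of $\mathbb{R}^n$ are functions on \<open>nat\<close> that vanish outside the index set \<open>{1..n}\<close>
  (the convention of \<open>standard_simplex\<close> in HOL-Homology, with indices starting at 1).
\<close>

definition simplex :: "nat \<Rightarrow> (nat \<Rightarrow> real) set" where
  "simplex n = {x. (\<forall>i\<in>{1..n}. 0 \<le> x i) \<and> (\<forall>i. i \<notin> {1..n} \<longrightarrow> x i = 0) \<and> (\<Sum>i=1..n. x i) = 1}"

definition b_le :: "nat \<Rightarrow> (nat \<Rightarrow> real) \<Rightarrow> (nat \<Rightarrow> real) \<Rightarrow> bool" where
  "b_le n x y \<longleftrightarrow> (\<forall>k\<in>{1..<n}. (\<Sum>i=1..k. x i) \<le> (\<Sum>i=1..k. y i))"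

text \<open>\<open>P i j k\<close> stands for $P_{ij,k}$; only its values at indices in \<open>{1..n}\<close> matter.\<close>

definition heredity_coeffs :: "nat \<Rightarrow> (nat \<Rightarrow> nat \<Rightarrow> nat \<Rightarrow> real) \<Rightarrow> bool" where
  "heredity_coeffs n P \<longleftrightarrow>
     (\<forall>i\<in>{1..n}. \<forall>j\<in>{1..n}.
        (\<forall>k\<in>{1..n}. 0 \<le> P i j k \<and> P i j k = P j i k) \<and> (\<Sum>k=1..n. P i j k) = 1)"

text \<open>\<open>V\<close> is only constrained on the simplex; its values elsewhere are irrelevant.\<close>

definition qso_with_coeffs ::
  "nat \<Rightarrow> (nat \<Rightarrow> nat \<Rightarrow> nat \<Rightarrow> real) \<Rightarrow> ((nat \<Rightarrow> real) \<Rightarrow> (nat \<Rightarrow> real)) \<Rightarrow> bool" where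
  "qso_with_coeffs n P V \<longleftrightarrow>
     heredity_coeffs n P \<and> V \<in> simplex n \<rightarrow> simplex n \<and>
     (\<forall>x\<in>simplex n. \<forall>k\<in>{1..n}. V x k = (\<Sum>i=1..n. \<Sum>j=1..n. P i j k * x i * x j))"

definition b_bistochastic :: "nat \<Rightarrow> ((nat \<Rightarrow> real) \<Rightarrow> (nat \<Rightarrow> real)) \<Rightarrow> bool" where
  "b_bistochastic n V \<longleftrightarrow>
     (\<exists>P. qso_with_coeffs n P V) \<and> (\<forall>x\<in>simplex n. b_le n (V x) x)"

definition l1_norm :: "nat \<Rightarrow> (nat \<Rightarrow> real) \<Rightarrow> real" where
  "l1_norm n x = (\<Sum>i=1..n. \<bar>x i\<bar>)"

definition strict_contraction :: "nat \<Rightarrow> ((nat \<Rightarrow> real) \<Rightarrow> (nat \<Rightarrow> real)) \<Rightarrow> bool" where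
  "strict_contraction n V \<longleftrightarrow>
     (\<exists>\<alpha>::real. 0 \<le> \<alpha> \<and> \<alpha> < 1 \<and>
        (\<forall>x\<in>simplex n. \<forall>y\<in>simplex n.
           l1_norm n (\<lambda>i. V x i - V y i) \<le> \<alpha> * l1_norm n (\<lambda>i. x i - y i)))"

end

theory Submission
  imports Defs
begin

text \<open>
  By symmetry of the heredity coefficients, \<open>V x - V y\<close> is the linear map with columns
  $\sum_i (x_i + y_i) P_{ij,\cdot}$ applied to \<open>x - y\<close>, a vector with coordinate sum \<open>0\<close>. On such
  vectors the $\ell_1$ operator norm of a matrix is half the largest $\ell_1$ distance of two columns
  (Dobrushin's coefficient). The midpoint $(x+y)/2$ ranges over the simplex, so by convexity the worst
  case sits at a vertex $e_i$, and \<open>V\<close> is a strict contraction iff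
  $\sum_k |P_{ij,k} - P_{il,k}| < 1$ for all $i, j, l$. For \<open>n = 3\<close>, b-bistochasticity kills
  $P_{22,1}$, $P_{23,1}$, $P_{33,1}$, $P_{33,2}$, and the nine quantities are these distances.
\<close>

section \<open>Contraction of zero-sum vectors in the l1 norm\<close>

text \<open>The positive and negative parts of \<open>d\<close> have the same mass \<open>D\<close>,
  half its l1 norm. The product coupling \<open>p j * q l / D\<close> then writes the image of
  \<open>d\<close> as a combination of column differences with total weight
  \<open>D\<close>.\<close>

lemma l1_dobrushin_bound:
  fixes a :: "'a \<Rightarrow> 'b \<Rightarrow> real" and d :: "'a \<Rightarrow> real"
  assumes fin: "finite J" and d0: "sum d J = 0"
    and M: "\<And>j l. j \<in> J \<Longrightarrow> l \<in> J \<Longrightarrow> (\<Sum>k\<in>K. \<bar>a j k - a l k\<bar>) \<le> M"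
  shows "(\<Sum>k\<in>K. \<bar>\<Sum>j\<in>J. a j k * d j\<bar>) \<le> M / 2 * (\<Sum>j\<in>J. \<bar>d j\<bar>)"
proof -
  define p where "p j = max (d j) 0" for j
  define q where "q j = max (- d j) 0" for j
  define D where "D = sum p J"
  have d: "d j = p j - q j" and ad: "\<bar>d j\<bar> = p j + q j" and pq: "p j \<ge> 0" "q j \<ge> 0" for j
    by (auto simp: p_def q_def)
  have qD: "sum q J = D"
    using d0 by (simp add: d sum_subtractf D_def)
  have norm_d: "(\<Sum>j\<in>J. \<bar>d j\<bar>) = 2 * D"
    by (simp add: ad sum.distrib qD flip: D_def)
  have D0: "D \<ge> 0"
    unfolding D_def by (intro sum_nonneg pq)
  show ?thesis
  \<comment> \<open>The coupling identity is used multiplied through by \<open>D\<close>, which has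
    to be cancelled at the end.\<close>
  proof (cases "D = 0")
    case True
    then have "\<forall>j\<in>J. d j = 0"
      using norm_d fin by (simp add: sum_nonneg_eq_0_iff)
    then show ?thesis by simp
  next
    case False
    have transport: "D * (\<Sum>j\<in>J. a j k * d j) = (\<Sum>j\<in>J. \<Sum>l\<in>J. p j * q l * (a j k - a l k))" for k
    proof -
      have "(\<Sum>j\<in>J. \<Sum>l\<in>J. p j * q l * (a j k - a l k))
          = (\<Sum>j\<in>J. \<Sum>l\<in>J. (a j k * p j) * q l) - (\<Sum>j\<in>J. \<Sum>l\<in>J. p j * (a l k * q l))"
        by (simp add: sum_subtractf algebra_simps)
      also have "\<dots> = (\<Sum>j\<in>J. a j k * p j) * sum q J - sum p J * (\<Sum>l\<in>J. a l k * q l)"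
        by (simp only: sum_product)
      finally show ?thesis
        unfolding qD D_def[symmetric] by (simp add: d algebra_simps sum_subtractf)
    qed
    have "D * (\<Sum>k\<in>K. \<bar>\<Sum>j\<in>J. a j k * d j\<bar>) = (\<Sum>k\<in>K. \<bar>D * (\<Sum>j\<in>J. a j k * d j)\<bar>)"
      using D0 by (subst sum_distrib_left) (simp add: abs_mult)
    also have "\<dots> \<le> (\<Sum>k\<in>K. \<Sum>j\<in>J. \<Sum>l\<in>J. p j * q l * \<bar>a j k - a l k\<bar>)"
      unfolding transport
      by (intro sum_mono order_trans[OF sum_abs]) (simp add: abs_mult pq)
    also have "\<dots> = (\<Sum>j\<in>J. \<Sum>k\<in>K. \<Sum>l\<in>J. p j * q l * \<bar>a j k - a l k\<bar>)"
      by (rule sum.swap)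
    also have "\<dots> = (\<Sum>j\<in>J. \<Sum>l\<in>J. p j * q l * (\<Sum>k\<in>K. \<bar>a j k - a l k\<bar>))"
      by (intro sum.cong refl) (subst sum.swap, simp add: sum_distrib_left)
    also have "\<dots> \<le> (\<Sum>j\<in>J. \<Sum>l\<in>J. p j * q l * M)"
      by (intro sum_mono mult_left_mono M mult_nonneg_nonneg pq)
    also have "\<dots> = D * (D * M)"
    proof -
      have "(\<Sum>j\<in>J. \<Sum>l\<in>J. p j * q l) = D * D"
        by (simp only: sum_product[symmetric] qD D_def[symmetric])
      then show ?thesis
        by (simp add: sum_distrib_right[symmetric])
    qed
    finally have "(\<Sum>k\<in>K. \<bar>\<Sum>j\<in>J. a j k * d j\<bar>) \<le> D * M"
      using False D0 by simp
    then show ?thesis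
      by (simp add: norm_d mult.commute)
  qed
qed

section \<open>Lipschitz bound from the heredity coefficients\<close>

text \<open>Polarization: a symmetric bilinear form satisfies B(x,x) - B(y,y) = B(x+y, x-y), because
  the mixed terms cancel.\<close>

lemma qso_diff:
  assumes V: "qso_with_coeffs n P V" and x: "x \<in> simplex n" and y: "y \<in> simplex n"
    and k: "k \<in> {1..n}"
  shows "V x k - V y k = (\<Sum>j=1..n. (\<Sum>i=1..n. (x i + y i) * P i j k) * (x j - y j))"
proof -
  have sym: "P i j k = P j i k" if "i \<in> {1..n}" "j \<in> {1..n}" for i j
    using V k that unfolding qso_with_coeffs_def heredity_coeffs_def by blast
  have val: "V z k = (\<Sum>j=1..n. \<Sum>i=1..n. P i j k * z i * z j)" if "z \<in> simplex n" for z
  proof -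
    have "V z k = (\<Sum>i=1..n. \<Sum>j=1..n. P i j k * z i * z j)"
      using V k that unfolding qso_with_coeffs_def by blast
    also have "\<dots> = (\<Sum>j=1..n. \<Sum>i=1..n. P i j k * z i * z j)"
      by (rule sum.swap)
    finally show ?thesis .
  qed
  have cross: "(\<Sum>j=1..n. \<Sum>i=1..n. P i j k * y i * x j) = (\<Sum>j=1..n. \<Sum>i=1..n. P i j k * x i * y j)"
    by (subst sum.swap) (auto intro!: sum.cong simp: sym)
  have "(\<Sum>j=1..n. (\<Sum>i=1..n. (x i + y i) * P i j k) * (x j - y j))
      = (\<Sum>j=1..n. \<Sum>i=1..n. P i j k * x i * x j) - (\<Sum>j=1..n. \<Sum>i=1..n. P i j k * y i * y j)
      + ((\<Sum>j=1..n. \<Sum>i=1..n. P i j k * y i * x j) - (\<Sum>j=1..n. \<Sum>i=1..n. P i j k * x i * y j))"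
    unfolding sum_distrib_right sum_subtractf[symmetric] sum.distrib[symmetric]
    by (intro sum.cong refl) (simp add: algebra_simps)
  then show ?thesis
    using cross by (simp add: val x y)
qed

text \<open>The weights \<open>x i + y i\<close> have total mass 2, so the columns
  \<open>c j\<close> are at most \<open>2 * M\<close> apart; this 2 cancels the factor 1/2 in
  Dobrushin's bound.\<close>

lemma qso_lipschitz:
  assumes V: "qso_with_coeffs n P V" and x: "x \<in> simplex n" and y: "y \<in> simplex n"
    and M: "\<And>i j l. i \<in> {1..n} \<Longrightarrow> j \<in> {1..n} \<Longrightarrow> l \<in> {1..n}
              \<Longrightarrow> (\<Sum>k=1..n. \<bar>P i j k - P i l k\<bar>) \<le> M"
  shows "l1_norm n (\<lambda>i. V x i - V y i) \<le> M * l1_norm n (\<lambda>i. x i - y i)"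
proof -
  define c where "c j k = (\<Sum>i=1..n. (x i + y i) * P i j k)" for j k
  have nonneg: "x i + y i \<ge> 0" if "i \<in> {1..n}" for i
    using x y that by (auto simp: simplex_def intro!: add_nonneg_nonneg)
  have sums: "(\<Sum>i=1..n. x i) = 1" "(\<Sum>i=1..n. y i) = 1"
    using x y by (auto simp: simplex_def)
  have cM: "(\<Sum>k=1..n. \<bar>c j k - c l k\<bar>) \<le> 2 * M" if jl: "j \<in> {1..n}" "l \<in> {1..n}" for j l
  proof -
    have "(\<Sum>k=1..n. \<bar>c j k - c l k\<bar>) \<le> (\<Sum>k=1..n. \<Sum>i=1..n. (x i + y i) * \<bar>P i j k - P i l k\<bar>)"
      unfolding c_def sum_subtractf[symmetric] right_diff_distrib[symmetric]
      by (intro sum_mono order_trans[OF sum_abs]) (simp add: abs_mult nonneg)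
    also have "\<dots> = (\<Sum>i=1..n. (x i + y i) * (\<Sum>k=1..n. \<bar>P i j k - P i l k\<bar>))"
      by (subst sum.swap) (simp add: sum_distrib_left)
    also have "\<dots> \<le> (\<Sum>i=1..n. (x i + y i) * M)"
      by (intro sum_mono mult_left_mono M jl nonneg)
    also have "\<dots> = 2 * M"
      by (simp only: sum_distrib_right[symmetric] sum.distrib sums one_add_one)
    finally show ?thesis .
  qed
  have "l1_norm n (\<lambda>i. V x i - V y i) = (\<Sum>k=1..n. \<bar>\<Sum>j=1..n. c j k * (x j - y j)\<bar>)"
    unfolding l1_norm_def c_def by (intro sum.cong refl) (simp add: qso_diff[OF V x y])
  also have "\<dots> \<le> 2 * M / 2 * (\<Sum>j=1..n. \<bar>x j - y j\<bar>)"
    by (rule l1_dobrushin_bound) (auto simp: sum_subtractf sums cM simp del: One_nat_def)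
  finally show ?thesis
    by (simp add: l1_norm_def)
qed

section \<open>Edges of the simplex and the lower bound on the Lipschitz constant\<close>

text \<open>Adding two indicators, instead of splitting cases on \<open>h\<close>, lets
  \<open>i = j\<close> give the vertex e_i.\<close>

definition edge_point :: "nat \<Rightarrow> nat \<Rightarrow> real \<Rightarrow> nat \<Rightarrow> real" where
  "edge_point i j t = (\<lambda>h. (1 - t) * of_bool (h = i) + t * of_bool (h = j))"

lemma sum_mult_of_bool_eq:
  fixes f :: "'a \<Rightarrow> real"
  assumes "finite S" "i \<in> S"
  shows "(\<Sum>h\<in>S. f h * of_bool (h = i)) = f i"
proof -
  have "(\<Sum>h\<in>S. f h * of_bool (h = i)) = (\<Sum>h\<in>S. if h = i then f h else 0)"
    by (intro sum.cong) auto
  then show ?thesis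
    using assms by simp
qed

lemma sum_mult_edge_point:
  assumes "finite S" "i \<in> S" "j \<in> S"
  shows "(\<Sum>h\<in>S. f h * edge_point i j t h) = (1 - t) * f i + t * f j"
proof -
  have "(\<Sum>h\<in>S. f h * edge_point i j t h)
      = (\<Sum>h\<in>S. ((1 - t) * f h) * of_bool (h = i)) + (\<Sum>h\<in>S. (t * f h) * of_bool (h = j))"
    by (simp add: edge_point_def algebra_simps flip: sum.distrib)
  then show ?thesis
    using assms by (simp only: sum_mult_of_bool_eq)
qed

lemma edge_point_in_simplex:
  assumes "i \<in> {1..n}" "j \<in> {1..n}" "0 \<le> t" "t \<le> 1"
  shows "edge_point i j t \<in> simplex n"
proof -
  have "(\<Sum>h=1..n. edge_point i j t h) = 1"
    using sum_mult_edge_point[of "{1..n}" i j "\<lambda>_. 1" t] assms(1,2) by simp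
  then show ?thesis
    using assms by (auto simp: simplex_def) (auto simp: edge_point_def)
qed

lemma qso_edge_point:
  assumes V: "qso_with_coeffs n P V" and ij: "i \<in> {1..n}" "j \<in> {1..n}" and k: "k \<in> {1..n}"
    and t: "0 \<le> t" "t \<le> 1"
  shows "V (edge_point i j t) k
           = (1 - t)\<^sup>2 * P i i k + 2 * t * (1 - t) * P i j k + t\<^sup>2 * P j j k"
proof -
  let ?x = "edge_point i j t"
  have sym: "P j i k = P i j k"
    using V ij k unfolding qso_with_coeffs_def heredity_coeffs_def by blast
  have "V ?x k = (\<Sum>g=1..n. \<Sum>h=1..n. P g h k * ?x g * ?x h)"
    using V edge_point_in_simplex[OF ij t] k unfolding qso_with_coeffs_def by blast
  also have "\<dots> = (\<Sum>g=1..n. ((1 - t) * P g i k + t * P g j k) * ?x g)"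
    by (intro sum.cong refl, subst sum_mult_edge_point) (use ij in \<open>simp_all add: algebra_simps\<close>)
  also have "\<dots> = (1 - t)\<^sup>2 * P i i k + 2 * t * (1 - t) * P i j k + t\<^sup>2 * P j j k"
    by (subst sum_mult_edge_point) (use ij in \<open>simp_all add: sym power2_eq_square algebra_simps\<close>)
  finally show ?thesis .
qed

text \<open>Two points leave the vertex e_i at equal speed towards e_j and e_l. Comparing their
  images to first order as \<open>t\<close> tends to 0 gives the bound: the \<open>P i i k\<close>
  terms cancel, and both sides carry a factor 2.\<close>

lemma strict_contraction_coeff_bound:
  assumes V: "qso_with_coeffs n P V" and i: "i \<in> {1..n}" and j: "j \<in> {1..n}" and l: "l \<in> {1..n}"
    and contr: "\<And>x y. x \<in> simplex n \<Longrightarrow> y \<in> simplex n \<Longrightarrow>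
        l1_norm n (\<lambda>i. V x i - V y i) \<le> \<alpha> * l1_norm n (\<lambda>i. x i - y i)"
    and "0 \<le> \<alpha>"
  shows "(\<Sum>k=1..n. \<bar>P i j k - P i l k\<bar>) \<le> \<alpha>"
proof -
  let ?f = "\<lambda>t. \<Sum>k=1..n. \<bar>2 * (1 - t) * (P i j k - P i l k) + t * (P j j k - P l l k)\<bar>"
  have f_le: "?f t \<le> 2 * \<alpha>" if t: "0 < t" "t < 1" for t
  proof -
    let ?x = "edge_point i j t" and ?y = "edge_point i l t"
    have xy: "?x \<in> simplex n" "?y \<in> simplex n"
      using i j l t by (auto intro!: edge_point_in_simplex)
    have "t * ?f t = l1_norm n (\<lambda>k. V ?x k - V ?y k)"
      unfolding l1_norm_def sum_distrib_left
    proof (intro sum.cong refl)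
      fix k assume k: "k \<in> {1..n}"
      have "V ?x k - V ?y k = t * (2 * (1 - t) * (P i j k - P i l k) + t * (P j j k - P l l k))"
        using t by (simp add: qso_edge_point[OF V i j k] qso_edge_point[OF V i l k]
            power2_eq_square algebra_simps)
      then show "t * \<bar>2 * (1 - t) * (P i j k - P i l k) + t * (P j j k - P l l k)\<bar>
          = \<bar>V ?x k - V ?y k\<bar>"
        using t by (simp add: abs_mult)
    qed
    also have "\<dots> \<le> \<alpha> * l1_norm n (\<lambda>k. ?x k - ?y k)"
      by (rule contr[OF xy])
    \<comment> \<open>An upper bound suffices since \<open>0 \<le> \<alpha>\<close>, so the case
      \<open>j = l\<close>, where the left side is 0, needs no separate treatment.\<close>
    also have "l1_norm n (\<lambda>k. ?x k - ?y k) \<le> (\<Sum>k=1..n. t * of_bool (k = j) + t * of_bool (k = l))"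
      unfolding l1_norm_def using t by (intro sum_mono) (auto simp: edge_point_def)
    also have "\<dots> = 2 * t"
      using j l by (simp only: sum.distrib sum_mult_of_bool_eq finite_atLeastAtMost)
    finally have "t * ?f t \<le> \<alpha> * (2 * t)"
      using \<open>0 \<le> \<alpha>\<close> by (simp add: mult_left_mono)
    then have "t * ?f t \<le> t * (2 * \<alpha>)"
      by (simp only: ac_simps)
    then show ?thesis
      using t by simp
  qed
  \<comment> \<open>The limit is left unsimplified so that it has the shape produced by
    \<open>tendsto_intros\<close>.\<close>
  have "(?f \<longlongrightarrow> (\<Sum>k=1..n. \<bar>2 * (1 - 0) * (P i j k - P i l k) + 0 * (P j j k - P l l k)\<bar>)) (at_right 0)"
    by (intro tendsto_intros)
  moreover have "\<forall>\<^sub>F t in at_right 0. ?f t \<le> 2 * \<alpha>"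
    using eventually_at_right_less eventually_at_right_real[OF zero_less_one]
    by eventually_elim (rule f_le, simp_all)
  ultimately have "(\<Sum>k=1..n. \<bar>2 * (1 - 0) * (P i j k - P i l k) + 0 * (P j j k - P l l k)\<bar>) \<le> 2 * \<alpha>"
    by (rule tendsto_upperbound) simp
  then have "2 * (\<Sum>k=1..n. \<bar>P i j k - P i l k\<bar>) \<le> 2 * \<alpha>"
    by (simp add: abs_mult sum_distrib_left del: right_diff_distrib_numeral)
  then show ?thesis by simp
qed

section \<open>The contraction criterion in any dimension\<close>

theorem strict_contraction_iff:
  assumes V: "qso_with_coeffs n P V"
  shows "strict_contraction n V \<longleftrightarrow>
    (\<forall>i\<in>{1..n}. \<forall>j\<in>{1..n}. \<forall>l\<in>{1..n}. (\<Sum>k=1..n. \<bar>P i j k - P i l k\<bar>) < 1)"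
proof
  assume "strict_contraction n V"
  then show "\<forall>i\<in>{1..n}. \<forall>j\<in>{1..n}. \<forall>l\<in>{1..n}. (\<Sum>k=1..n. \<bar>P i j k - P i l k\<bar>) < 1"
    unfolding strict_contraction_def
    using strict_contraction_coeff_bound[OF V] by (meson le_less_trans)
next
  assume lt: "\<forall>i\<in>{1..n}. \<forall>j\<in>{1..n}. \<forall>l\<in>{1..n}. (\<Sum>k=1..n. \<bar>P i j k - P i l k\<bar>) < 1"
  define S where "S = (\<lambda>(i, j, l). \<Sum>k=1..n. \<bar>P i j k - P i l k\<bar>) ` ({1..n} \<times> {1..n} \<times> {1..n})"
  \<comment> \<open>Inserting 0 makes \<open>\<alpha>\<close> nonnegative and keeps
    \<open>Max\<close> meaningful when \<open>n = 0\<close>. Since \<open>S\<close> is finite, the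
    strict bounds yield one constant below 1.\<close>
  define \<alpha> where "\<alpha> = Max (insert 0 S)"
  have fin: "finite S"
    by (simp add: S_def)
  have "\<alpha> < 1"
    unfolding \<alpha>_def using lt fin by (auto simp: S_def simp del: One_nat_def)
  moreover have "0 \<le> \<alpha>"
    unfolding \<alpha>_def using fin by simp
  moreover have "(\<Sum>k=1..n. \<bar>P i j k - P i l k\<bar>) \<le> \<alpha>"
    if "i \<in> {1..n}" "j \<in> {1..n}" "l \<in> {1..n}" for i j l
    unfolding \<alpha>_def using fin that by (intro Max_ge) (force simp: S_def)+
  ultimately show "strict_contraction n V"
    unfolding strict_contraction_def using qso_lipschitz[OF V] by blast
qed

section \<open>The b-bistochastic case in dimension three\<close>

text \<open>Where a partial sum of \<open>x\<close> vanishes, the b-order forces the same partial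
  sum of \<open>V x\<close>, a nonnegative combination of coefficients, to vanish. The test points
  are e_2, e_3 and the midpoint of their edge.\<close>

lemma b_bistochastic_zero_coeffs:
  assumes V: "qso_with_coeffs 3 P V" and b: "b_bistochastic 3 V"
  shows "P 2 2 1 = 0" "P 2 3 1 = 0" "P 3 3 1 = 0" "P 3 3 2 = 0"
proof -
  have nonneg: "P i j k \<ge> 0" if "i \<in> {1..3}" "j \<in> {1..3}" "k \<in> {1..3}" for i j k
    using V that unfolding qso_with_coeffs_def heredity_coeffs_def by blast
  have le: "(\<Sum>h=1..k. V (edge_point i j t) h) \<le> (\<Sum>h=1..k. edge_point i j t h)"
    if "i \<in> {1..3}" "j \<in> {1..3}" "0 \<le> t" "t \<le> 1" "k \<in> {1..<3}" for i j k t
    using b that edge_point_in_simplex[of i 3 j t] unfolding b_bistochastic_def b_le_def by blast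
  have two: "{1..2} = {1, 2::nat}" by auto
  show 221: "P 2 2 1 = 0"
    using le[of 2 2 0 1] nonneg[of 2 2 1] qso_edge_point[OF V, of 2 2 1 0]
    by (simp add: edge_point_def)
  show 331: "P 3 3 1 = 0"
    using le[of 3 3 0 1] nonneg[of 3 3 1] qso_edge_point[OF V, of 3 3 1 0]
    by (simp add: edge_point_def)
  \<comment> \<open>At \<open>t = 1/2\<close> the mixed coefficient has weight 1/2, and the vertex
    terms are already known to be 0.\<close>
  show "P 2 3 1 = 0"
    using le[of 2 3 "1/2" 1] nonneg[of 2 3 1] qso_edge_point[OF V, of 2 3 1 "1/2"] 221 331
    by (simp add: edge_point_def)
  show "P 3 3 2 = 0"
    using le[of 3 3 0 2] nonneg[of 3 3 2] 331 qso_edge_point[OF V, of 3 3 1 0]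
      qso_edge_point[OF V, of 3 3 2 0]
    unfolding two by (simp add: edge_point_def)
qed

theorem theorem4p3:
  fixes V :: "(nat \<Rightarrow> real) \<Rightarrow> (nat \<Rightarrow> real)"
    and P :: "nat \<Rightarrow> nat \<Rightarrow> nat \<Rightarrow> real"
    and A1 A2 B1 B2 C1 C2 D2 E2 :: real
  assumes "qso_with_coeffs 3 P V"
    and "b_bistochastic 3 V"
    and "A1 = P 1 1 1" and "A2 = P 1 1 2"
    and "B1 = P 1 2 1" and "B2 = P 1 2 2"
    and "C1 = P 1 3 1" and "C2 = P 1 3 2"
    and "D2 = P 2 2 2" and "E2 = P 2 3 2"
  shows "strict_contraction 3 V \<longleftrightarrow>
    Max {\<bar>A1 - B1\<bar> + \<bar>A2 - B2\<bar> + \<bar>A1 + A2 - B1 - B2\<bar>,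
         B1 + \<bar>B2 - D2\<bar> + \<bar>B1 + B2 - D2\<bar>,
         C1 + \<bar>C2 - E2\<bar> + \<bar>C1 + C2 - E2\<bar>,
         \<bar>A1 - C1\<bar> + \<bar>A2 - C2\<bar> + \<bar>A1 + A2 - C1 - C2\<bar>,
         B1 + \<bar>B2 - E2\<bar> + \<bar>B1 + B2 - E2\<bar>,
         2 * C1 + 2 * C2,
         \<bar>B1 - C1\<bar> + \<bar>B2 - C2\<bar> + \<bar>B1 + B2 - C1 - C2\<bar>,
         2 * \<bar>D2 - E2\<bar>,
         2 * E2} < 1"
proof -
  define dst where "dst i j l = (\<Sum>k=1..3. \<bar>P i j k - P i l k\<bar>)" for i j l
  have three: "{1..3} = {1, 2, 3::nat}" by auto
  have coeffs: "P i j k \<ge> 0" "P i j k = P j i k" "P i j 3 = 1 - P i j 1 - P i j 2"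
    if "i \<in> {1..3}" "j \<in> {1..3}" "k \<in> {1..3}" for i j k
  proof -
    have "heredity_coeffs 3 P"
      using assms(1) by (simp add: qso_with_coeffs_def)
    moreover have "(\<Sum>k=1..3. P i j k) = P i j 1 + P i j 2 + P i j 3"
      unfolding three by simp
    ultimately show "P i j k \<ge> 0" "P i j k = P j i k" "P i j 3 = 1 - P i j 1 - P i j 2"
      using that unfolding heredity_coeffs_def by (force simp del: One_nat_def)+
  qed
  note zero = b_bistochastic_zero_coeffs[OF assms(1,2)]
  have sym: "P 2 1 k = P 1 2 k" "P 3 1 k = P 1 3 k" "P 3 2 k = P 2 3 k" if "k \<in> {1..3}" for k
    using that coeffs(2)[of _ _ k] by auto
  \<comment> \<open>Eliminating the third coordinate by
    \<open>P i j 3 = 1 - P i j 1 - P i j 2\<close> produces the last absolute value.\<close>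
  have dst: "dst i j l = \<bar>P i j 1 - P i l 1\<bar> + \<bar>P i j 2 - P i l 2\<bar>
      + \<bar>P i j 1 + P i j 2 - P i l 1 - P i l 2\<bar>"
    if "i \<in> {1..3}" "j \<in> {1..3}" "l \<in> {1..3}" for i j l
    using coeffs(3)[OF that(1,2), of 1] coeffs(3)[OF that(1,3), of 1]
    unfolding dst_def three by simp
  \<comment> \<open>These are the coefficients that get compared with a vanishing one, so their
    absolute values disappear.\<close>
  have nonneg: "B1 \<ge> 0" "C1 \<ge> 0" "C2 \<ge> 0" "E2 \<ge> 0"
    using coeffs(1) by (auto simp: assms(3-))
  have dists:
    "dst 1 1 2 = \<bar>A1 - B1\<bar> + \<bar>A2 - B2\<bar> + \<bar>A1 + A2 - B1 - B2\<bar>"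
    "dst 2 1 2 = B1 + \<bar>B2 - D2\<bar> + \<bar>B1 + B2 - D2\<bar>"
    "dst 3 1 2 = C1 + \<bar>C2 - E2\<bar> + \<bar>C1 + C2 - E2\<bar>"
    "dst 1 1 3 = \<bar>A1 - C1\<bar> + \<bar>A2 - C2\<bar> + \<bar>A1 + A2 - C1 - C2\<bar>"
    "dst 2 1 3 = B1 + \<bar>B2 - E2\<bar> + \<bar>B1 + B2 - E2\<bar>"
    "dst 3 1 3 = 2 * C1 + 2 * C2"
    "dst 1 2 3 = \<bar>B1 - C1\<bar> + \<bar>B2 - C2\<bar> + \<bar>B1 + B2 - C1 - C2\<bar>"
    "dst 2 2 3 = 2 * \<bar>D2 - E2\<bar>"
    "dst 3 2 3 = 2 * E2"
    using nonneg by (simp_all add: dst sym zero assms(3-) del: One_nat_def)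
  have "strict_contraction 3 V \<longleftrightarrow> (\<forall>i\<in>{1..3}. \<forall>j\<in>{1..3}. \<forall>l\<in>{1..3}. dst i j l < 1)"
    unfolding dst_def by (rule strict_contraction_iff[OF assms(1)])
  \<comment> \<open>For fixed \<open>i\<close>, \<open>dst i\<close> is symmetric and zero on the
    diagonal, so the 27 conditions reduce to 9.\<close>
  also have "\<dots> \<longleftrightarrow> (\<forall>i\<in>{1..3}. dst i 1 2 < 1 \<and> dst i 1 3 < 1 \<and> dst i 2 3 < 1)"
  proof -
    have "dst i j j = 0" for i j
      by (simp add: dst_def)
    moreover have "dst i 2 1 = dst i 1 2" "dst i 3 1 = dst i 1 3" "dst i 3 2 = dst i 2 3" for i
      by (simp_all add: dst_def abs_minus_commute)
    ultimately have "(\<forall>j\<in>{1..3}. \<forall>l\<in>{1..3}. dst i j l < 1)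
        \<longleftrightarrow> dst i 1 2 < 1 \<and> dst i 1 3 < 1 \<and> dst i 2 3 < 1" for i
      unfolding three by (auto simp del: One_nat_def)
    then show ?thesis by simp
  qed
  also have "\<dots> \<longleftrightarrow> Max {dst 1 1 2, dst 2 1 2, dst 3 1 2, dst 1 1 3, dst 2 1 3, dst 3 1 3,
      dst 1 2 3, dst 2 2 3, dst 3 2 3} < 1"
    unfolding three by (subst Max_less_iff) (auto simp del: One_nat_def)
  finally show ?thesis
    unfolding dists .
qed

end
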